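(* Let $A\in\mathbb{R}^{n\times n}$ be an invertible matrix, $1<p<\infty$, and $0<\varepsilon<1$ with $\varepsilon<p-1$. If $w\in\mathcal{A}_{A,p}$ is a weight such that $w^{1-p'}\in RH_s$ with $s=\frac{p-1}{p-\varepsilon-1}$, then $M_{A^{-1}}$ is bounded on $L^p(w)$, i.e. there is a constant $C$ such that $\int_{\mathbb{R}^n} (M_{A^{-1}}f)^p\, w\,dx\le C\int_{\mathbb{R}^n}|f|^p\, w\,dx$ for all $f\in L^p(w)$.
   Context: A weight is a locally integrable function $w$ on $\mathbb{R}^n$ with $0<w<\infty$ a.e.; $p'=p/(p-1)$. Cubes $Q$ have sides parallel to the axes. For an invertible matrix $A$, $w_A(x)=w(Ax)$ and $M_{A^{-1}}f(x)=Mf(A^{-1}x)=\sup_{Q\ni A^{-1}x}\frac1{|Q|}\int_Q|f(y)|\,dy$. For $1<p<\infty$, $w\in\mathcal{A}_{A,p}$ if $[w]_{\mathcal{A}_{A,p}}=\sup_Q \frac1{|Q|}\int_Q w_A(x)\,dx\left(\frac1{|Q|}\int_Q w(x)^{-\frac1{p-1}}\,dx\right)^{p-1}<\infty$. For $1<s<\infty$, a weight $v$ belongs to the reverse Hölder class $RH_s$ if there is a constant $C$ such that $\left(\frac1{|Q|}\int_Q v^s\right)^{1/s}\le C\,\frac1{|Q|}\int_Q v$ for every cube $Q$. *)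

theory Defs
  imports "HOL-Analysis.Analysis"
begin

text \<open>Weights are real-valued, so \<open>w < \<infinity>\<close> is automatic; Lebesgue measurability is part of
  integrability on every compact set.\<close>

definition weight :: "(real^'n \<Rightarrow> real) \<Rightarrow> bool" where
  "weight w \<longleftrightarrow>
     (\<forall>K. compact K \<longrightarrow> set_integrable lebesgue K w) \<and> (AE x in lebesgue. 0 < w x)"

definition cubes :: "(real^'n) set set" where
  "cubes = {cbox a b |a b. \<exists>l>0. \<forall>i. b $ i = a $ i + l}"

text \<open>The real power on \<open>[0,\<infinity>]\<close>, only meant for exponents \<open>r > 0\<close>.\<close>

definition epowr :: "ennreal \<Rightarrow> real \<Rightarrow> ennreal" where
  "epowr x r = (if x = top then top else ennreal (enn2real x powr r))"

text \<open>Averages are only taken of functions that are nonnegative almost everywhere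
  (\<open>ennreal\<close> sends negative reals to \<open>0\<close>), with value \<open>\<infinity>\<close> allowed.\<close>

definition avg :: "(real^'n) set \<Rightarrow> (real^'n \<Rightarrow> real) \<Rightarrow> ennreal" where
  "avg Q g = (\<integral>\<^sup>+x\<in>Q. ennreal (g x) \<partial>lebesgue) / emeasure lebesgue Q"

definition maximal :: "(real^'n \<Rightarrow> real) \<Rightarrow> real^'n \<Rightarrow> ennreal" where
  "maximal f x = (SUP Q\<in>{Q \<in> cubes. x \<in> Q}. avg Q (\<lambda>y. \<bar>f y\<bar>))"

definition maximal_inv :: "real^'n^'n \<Rightarrow> (real^'n \<Rightarrow> real) \<Rightarrow> real^'n \<Rightarrow> ennreal" where
  "maximal_inv A f x = maximal f (matrix_inv A *v x)"

definition conj_exp :: "real \<Rightarrow> real" where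
  "conj_exp p = p / (p - 1)"

definition Ap_const :: "real^'n^'n \<Rightarrow> real \<Rightarrow> (real^'n \<Rightarrow> real) \<Rightarrow> ennreal" where
  "Ap_const A p w =
     (SUP Q\<in>cubes. avg Q (\<lambda>x. w (A *v x)) * epowr (avg Q (\<lambda>x. w x powr (- 1 / (p - 1)))) (p - 1))"

definition Ap_class :: "real^'n^'n \<Rightarrow> real \<Rightarrow> (real^'n \<Rightarrow> real) set" where
  "Ap_class A p = {w. weight w \<and> Ap_const A p w < top}"

definition RH_class :: "real \<Rightarrow> (real^'n \<Rightarrow> real) set" where
  "RH_class s = {v. weight v \<and>
     (\<exists>C::real. \<forall>Q\<in>cubes. epowr (avg Q (\<lambda>x. v x powr s)) (1 / s) \<le> ennreal C * avg Q v)}"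

definition Lp_weighted :: "real \<Rightarrow> (real^'n \<Rightarrow> real) \<Rightarrow> (real^'n \<Rightarrow> real) set" where
  "Lp_weighted p w = {f \<in> borel_measurable lebesgue.
     (\<integral>\<^sup>+x. ennreal (\<bar>f x\<bar> powr p) * ennreal (w x) \<partial>lebesgue) < top}"

end

theory Submission
  imports Defs
begin

text \<open>Substituting \<open>x = A y\<close> turns the claim into a two-weight bound for the maximal operator, from
  \<open>L\<^sup>p(w)\<close> to \<open>L\<^sup>p(v)\<close> with \<open>v(y) = w(A y)\<close>. Put \<open>q = p - \<epsilon>\<close>. The reverse Hoelder exponent
  is \<open>s = (p - 1) / (q - 1)\<close>, so the reverse Hoelder inequality upgrades the \<open>A\<^sub>p\<close> condition on the pair
  \<open>(v, w)\<close> to the \<open>A\<^sub>q\<close> condition. By Hoelder's inequality and the Vitali covering lemma, the latter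
  gives the weak type \<open>(q, q)\<close> inequality, and the Marcinkiewicz argument against the trivial
  bound on \<open>L\<^sup>\<infinity>\<close> gives the strong type \<open>(p, p)\<close> inequality.\<close>

section \<open>Powers in the extended nonnegative reals and Hoelder's inequality\<close>

lemma epowr_ennreal: "0 \<le> x \<Longrightarrow> epowr (ennreal x) r = ennreal (x powr r)"
  by (simp add: epowr_def)

lemma epowr_top [simp]: "epowr top r = top"
  by (simp add: epowr_def)

lemma epowr_zero [simp]: "epowr 0 r = 0"
  by (simp add: epowr_def)

lemma epowr_mono:
  assumes "0 \<le> r" "x \<le> y" shows "epowr x r \<le> epowr y r"
proof (cases "y = top")
  case False
  then have "x \<noteq> top"
    using assms(2) top.extremum_uniqueI by auto
  with False assms show ?thesis
    by (auto simp: epowr_def less_top intro!: ennreal_leI powr_mono2 enn2real_mono)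
qed simp

lemma epowr_eq_0_iff [simp]: "epowr x r = 0 \<longleftrightarrow> x = 0"
  by (cases x) (auto simp: epowr_ennreal)

text \<open>The convention \<open>0 * top = 0\<close> is respected because \<open>epowr\<close>
  fixes \<open>0\<close> and \<open>top\<close> for every exponent and maps no other value to
  them.\<close>

lemma epowr_mult:
  "epowr (x * y) r = epowr x r * epowr y r"
  by (cases x; cases y)
     (auto simp: epowr_ennreal ennreal_mult_top ennreal_top_mult powr_mult simp flip: ennreal_mult)

lemma epowr_epowr: "epowr (epowr x a) b = epowr x (a * b)"
  by (cases x) (auto simp: epowr_ennreal powr_powr)

lemma epowr_less_top: "x < top \<Longrightarrow> epowr x r < top"
  by (auto simp: epowr_def)

lemma borel_measurable_epowr [measurable (raw)]:
  assumes [measurable]: "f \<in> borel_measurable M"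
  shows "(\<lambda>x. epowr (f x) r) \<in> borel_measurable M"
  unfolding epowr_def by measurable

text \<open>Young's inequality, applied after normalizing both factors. The usual inequality is
  raised to the power \<open>q\<close>, so that the last factor has the shape occurring in an A_q
  constant.\<close>

lemma Holder_nn_integral:
  assumes q: "1 < q"
    and [measurable]: "F \<in> borel_measurable M" "G \<in> borel_measurable M"
    and nonneg: "\<And>x. 0 \<le> F x" "\<And>x. 0 \<le> G x"
  shows "epowr (\<integral>\<^sup>+x. ennreal (F x * G x) \<partial>M) q
    \<le> (\<integral>\<^sup>+x. ennreal (F x powr q) \<partial>M) * epowr (\<integral>\<^sup>+x. ennreal (G x powr (q / (q - 1))) \<partial>M) (q - 1)"
    (is "_ \<le> ?a * epowr ?b _")
proof -
  consider "?a = 0 \<or> ?b = 0" | "?a \<noteq> 0" "?b \<noteq> 0" "?a = top \<or> ?b = top"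
    | "?a \<noteq> 0" "?b \<noteq> 0" "?a \<noteq> top" "?b \<noteq> top" by blast
  then show ?thesis
  proof cases
    \<comment> \<open>The right side is \<open>0\<close> here even if its other factor is
      \<open>top\<close>, so the left side must be shown to vanish: one of \<open>F\<close> and
      \<open>G\<close> is zero almost everywhere.\<close>
    case 1
    then have "AE x in M. F x * G x = 0"
    proof
      assume "?a = 0"
      then have "AE x in M. ennreal (F x powr q) = 0"
        by (subst (asm) nn_integral_0_iff_AE) auto
      then show ?thesis by eventually_elim (auto simp: ennreal_eq_0_iff)
    next
      assume "?b = 0"
      then have "AE x in M. ennreal (G x powr (q / (q - 1))) = 0"
        by (subst (asm) nn_integral_0_iff_AE) auto
      then show ?thesis by eventually_elim (auto simp: ennreal_eq_0_iff)
    qed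
    then have "(\<integral>\<^sup>+x. ennreal (F x * G x) \<partial>M) = 0"
      by (subst nn_integral_0_iff_AE) auto
    then show ?thesis by simp
  next
    case 2
    then show ?thesis by (auto simp: ennreal_mult_eq_top_iff)
  next
    case 3
    define a b where "a = enn2real ?a" and "b = enn2real ?b"
    have a: "?a = ennreal a" "0 < a" and b: "?b = ennreal b" "0 < b"
      using 3 by (auto simp: a_def b_def less_top enn2real_positive_iff zero_less_iff_neq_zero)
    \<comment> \<open>\<open>s\<close> is the product of the norms of \<open>F\<close> and
      \<open>G\<close> for the exponents \<open>q\<close> and \<open>q / (q - 1)\<close>. Young's
      inequality for the normalized functions, multiplied by \<open>s\<close>, integrates to
      \<open>s / q + s * (q - 1) / q = s\<close>.\<close>
    define s where "s = a powr (1/q) * b powr ((q - 1)/q)"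
    have s: "0 < s" using a b by (simp add: s_def)
    have "ennreal (F x * G x) \<le> ennreal (s / (q * a)) * ennreal (F x powr q)
        + ennreal (s * (q - 1) / (q * b)) * ennreal (G x powr (q / (q - 1)))" for x
    proof -
      have "(F x / a powr (1/q)) * (G x / b powr ((q-1)/q))
         \<le> (F x / a powr (1/q)) powr q / q + (G x / b powr ((q-1)/q)) powr (q / (q-1)) / (q / (q-1))"
        using q nonneg[of x] a b by (intro Youngs_inequality) (auto simp: field_simps)
      also have "\<dots> = F x powr q / (q * a) + (q - 1) * G x powr (q / (q-1)) / (q * b)"
        using q nonneg[of x] a b by (simp add: powr_divide powr_powr field_simps)
      finally have "s * ((F x / a powr (1/q)) * (G x / b powr ((q-1)/q)))
         \<le> s * (F x powr q / (q * a) + (q - 1) * G x powr (q / (q-1)) / (q * b))"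
        using s by (intro mult_left_mono) auto
      moreover have "s * ((F x / a powr (1/q)) * (G x / b powr ((q-1)/q))) = F x * G x"
        using a b by (simp add: s_def)
      ultimately have "F x * G x \<le> s / (q * a) * F x powr q + s * (q - 1) / (q * b) * G x powr (q / (q - 1))"
        by (simp add: algebra_simps)
      then show ?thesis
        using s q a b by (simp flip: ennreal_mult ennreal_plus)
    qed
    then have "(\<integral>\<^sup>+x. ennreal (F x * G x) \<partial>M) \<le>
       (\<integral>\<^sup>+x. ennreal (s / (q * a)) * ennreal (F x powr q)
        + ennreal (s * (q - 1) / (q * b)) * ennreal (G x powr (q / (q - 1))) \<partial>M)"
      by (rule nn_integral_mono)
    also have "\<dots> = ennreal (s / (q * a)) * ?a + ennreal (s * (q - 1) / (q * b)) * ?b"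
      by (simp add: nn_integral_add nn_integral_cmult)
    also have "\<dots> = ennreal s"
    proof -
      have "s / q + s * (q - 1) / q = s" using q by (simp add: field_simps)
      then show ?thesis
        using s q a b by (simp flip: ennreal_mult ennreal_plus)
    qed
    finally have "epowr (\<integral>\<^sup>+x. ennreal (F x * G x) \<partial>M) q \<le> epowr (ennreal s) q"
      using q by (intro epowr_mono) auto
    also have "\<dots> = ennreal a * epowr (ennreal b) (q - 1)"
      using q a b s by (simp add: epowr_ennreal s_def powr_mult powr_powr flip: ennreal_mult)
    finally show ?thesis using a b by simp
  qed
qed

section \<open>Linear change of variables\<close>

lemma nn_integral_shift:
  fixes t :: "'a::euclidean_space"
  assumes [measurable]: "g \<in> borel_measurable borel"
  shows "(\<integral>\<^sup>+x. g (x + t) \<partial>lborel) = (\<integral>\<^sup>+x. g x \<partial>lborel)"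
proof -
  have "(\<integral>\<^sup>+x. g x \<partial>lborel) = (\<integral>\<^sup>+x. g x \<partial>distr lborel borel ((+) t))"
    by (simp add: lborel_distr_plus)
  also have "\<dots> = (\<integral>\<^sup>+x. g (t + x) \<partial>lborel)"
    by (subst nn_integral_distr) auto
  finally show ?thesis by (simp add: add.commute)
qed

text \<open>Uniqueness of Haar measure: with \<open>u\<close> the indicator of the unit cube, translate \<open>x\<close> and then \<open>y\<close>
  in the double integral of \<open>g (T x) * u y\<close>. The change of variables formulas of
  \<^theory>\<open>HOL-Analysis.Change_Of_Vars\<close> need a well-ordered index type.\<close>

lemma nn_integral_lborel_linear:
  fixes T S :: "'a::euclidean_space \<Rightarrow> 'a"
  assumes lin: "linear T" "linear S" and inv: "\<And>x. T (S x) = x" "\<And>x. S (T x) = x"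
  obtains c :: ennreal where "c < top"
    "\<And>g. g \<in> borel_measurable borel \<Longrightarrow> (\<integral>\<^sup>+x. g (T x) \<partial>lborel) = c * (\<integral>\<^sup>+x. g x \<partial>lborel)"
proof -
  define u :: "'a \<Rightarrow> ennreal" where "u = indicator (cbox 0 One)"
  have [measurable]: "u \<in> borel_measurable borel" by (simp add: u_def)
  have int_u: "(\<integral>\<^sup>+y. u y \<partial>lborel) = 1"
    by (simp add: u_def emeasure_lborel_cbox_eq)
  have bl: "bounded_linear T" "bounded_linear S"
    using lin by (simp_all add: linear_conv_bounded_linear)
  have [measurable]: "T \<in> borel_measurable borel"
    by (intro borel_measurable_continuous_onI linear_continuous_on bl)
  have Tadd: "T (x + S y) = T x + y" for x y
    using lin inv by (simp add: linear_add)
  define c where "c = (\<integral>\<^sup>+x. u (- T x) \<partial>lborel)"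
  have "c < top"
  proof -
    \<comment> \<open>The integrand defining \<open>c\<close> is the indicator of this image of the
      unit cube, so boundedness of the image makes \<open>c\<close> finite.\<close>
    have "bounded ((\<lambda>y. S (- y)) ` cbox 0 One)"
      by (intro bounded_linear_image[OF bounded_cbox]
          bounded_linear_compose[OF bl(2) bounded_linear_minus[OF bounded_linear_ident]])
    then obtain a b where ab: "(\<lambda>y. S (- y)) ` cbox 0 One \<subseteq> cbox a b"
      by (metis bounded_subset_cbox_symmetric)
    have "u (- T x) \<le> indicator (cbox a b) x" for x
    proof (cases "- T x \<in> cbox 0 One")
      case True
      then have "S (- (- T x)) \<in> cbox a b" using ab by blast
      then show ?thesis by (simp add: inv u_def indicator_def)
    qed (simp add: u_def)
    then have "c \<le> (\<integral>\<^sup>+x. indicator (cbox a b) x \<partial>lborel)"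
      unfolding c_def by (rule nn_integral_mono)
    then show ?thesis
      using emeasure_lborel_cbox_finite[of a b] by (simp add: order_le_less_trans)
  qed
  moreover have "(\<integral>\<^sup>+x. g (T x) \<partial>lborel) = c * (\<integral>\<^sup>+x. g x \<partial>lborel)"
    if [measurable]: "g \<in> borel_measurable borel" for g
  proof -
    have "(\<integral>\<^sup>+x. g (T x) \<partial>lborel) = (\<integral>\<^sup>+y. (\<integral>\<^sup>+x. g (T x) \<partial>lborel) * u y \<partial>lborel)"
      by (subst nn_integral_cmult) (auto simp: int_u)
    also have "\<dots> = (\<integral>\<^sup>+y. (\<integral>\<^sup>+x. g (T x + y) \<partial>lborel) * u y \<partial>lborel)"
    proof (rule nn_integral_cong)
      fix y
      show "(\<integral>\<^sup>+x. g (T x) \<partial>lborel) * u y = (\<integral>\<^sup>+x. g (T x + y) \<partial>lborel) * u y"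
        using nn_integral_shift[of "\<lambda>x. g (T x)" "S y"] by (simp add: Tadd)
    qed
    also have "\<dots> = (\<integral>\<^sup>+y. \<integral>\<^sup>+x. g (T x + y) * u y \<partial>lborel \<partial>lborel)"
      by (simp add: nn_integral_multc)
    also have "\<dots> = (\<integral>\<^sup>+x. \<integral>\<^sup>+y. g (T x + y) * u y \<partial>lborel \<partial>lborel)"
      by (rule lborel_pair.Fubini') simp
    also have "\<dots> = (\<integral>\<^sup>+x. \<integral>\<^sup>+y. g y * u (y - T x) \<partial>lborel \<partial>lborel)"
    proof (rule nn_integral_cong)
      fix x
      show "(\<integral>\<^sup>+y. g (T x + y) * u y \<partial>lborel) = (\<integral>\<^sup>+y. g y * u (y - T x) \<partial>lborel)"
        using nn_integral_shift[of "\<lambda>y. g y * u (y - T x)" "T x"] by (simp add: add.commute)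
    qed
    also have "\<dots> = (\<integral>\<^sup>+y. \<integral>\<^sup>+x. g y * u (y - T x) \<partial>lborel \<partial>lborel)"
      by (rule lborel_pair.Fubini') simp
    also have "\<dots> = (\<integral>\<^sup>+y. g y * c \<partial>lborel)"
    \<comment> \<open>Translating \<open>x\<close> by \<open>S y\<close> turns
      \<open>u (y - T x)\<close> into \<open>u (- T x)\<close>, so the inner integral of
      \<open>u\<close> is \<open>c\<close> for every \<open>y\<close>.\<close>
    proof (rule nn_integral_cong)
      fix y
      have "(\<integral>\<^sup>+x. u (y - T x) \<partial>lborel) = c"
        using nn_integral_shift[of "\<lambda>x. u (y - T x)" "S y"] by (simp add: Tadd c_def)
      then show "(\<integral>\<^sup>+x. g y * u (y - T x) \<partial>lborel) = g y * c"
        by (simp add: nn_integral_cmult)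
    qed
    finally show ?thesis by (simp add: nn_integral_multc mult.commute[of c])
  qed
  ultimately show thesis by (rule that)
qed

text \<open>Passage from Borel to Lebesgue measurable integrands. The Borel formula for indicators
  shows that preimages of null sets are null; hence \<open>T\<close> is measurable for the completed
  measure, and \<open>g\<close> may be replaced by a Borel function equal to it almost
  everywhere.\<close>

lemma nn_integral_lebesgue_linear:
  fixes T S :: "'a::euclidean_space \<Rightarrow> 'a"
  assumes lin: "linear T" "linear S" and inv: "\<And>x. T (S x) = x" "\<And>x. S (T x) = x"
  obtains c :: ennreal where "c < top" "T \<in> lebesgue \<rightarrow>\<^sub>M lebesgue"
    "\<And>g. g \<in> borel_measurable lebesgue \<Longrightarrow> (\<integral>\<^sup>+x. g (T x) \<partial>lebesgue) = c * (\<integral>\<^sup>+x. g x \<partial>lebesgue)"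
proof -
  obtain c where c: "c < top"
    "\<And>g. g \<in> borel_measurable borel \<Longrightarrow> (\<integral>\<^sup>+x. g (T x) \<partial>lborel) = c * (\<integral>\<^sup>+x. g x \<partial>lborel)"
    using nn_integral_lborel_linear[OF assms] by blast
  have bl: "bounded_linear T"
    using lin by (simp_all add: linear_conv_bounded_linear)
  have [measurable]: "T \<in> borel_measurable borel"
    by (intro borel_measurable_continuous_onI linear_continuous_on bl)
  have null: "T -` N \<in> null_sets lborel" if "N \<in> null_sets lborel" for N
  proof -
    have [measurable]: "N \<in> sets borel" and N: "emeasure lborel N = 0"
      using that by auto
    have TN: "T -` N \<in> sets borel"
      using measurable_sets[of T borel borel N] by simp
    then have "emeasure lborel (T -` N) = (\<integral>\<^sup>+x. indicator (T -` N) x \<partial>lborel)"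
      by simp
    also have "\<dots> = (\<integral>\<^sup>+x. indicator N (T x) \<partial>lborel)"
      by (rule nn_integral_cong) (simp add: indicator_def)
    also have "\<dots> = 0"
      using N by (subst c(2)) auto
    finally show ?thesis using TN by auto
  qed
  have meas: "T \<in> lebesgue \<rightarrow>\<^sub>M lebesgue"
  proof (rule completion.measurable_completion2)
    show "T \<in> lebesgue \<rightarrow>\<^sub>M lborel"
      by (simp add: measurable_completion)
    show "null_sets lborel \<subseteq> null_sets (distr lebesgue lborel T)"
    proof
      fix N :: "'a set" assume N: "N \<in> null_sets lborel"
      have "T \<in> lebesgue \<rightarrow>\<^sub>M lborel" by (simp add: measurable_completion)
      with N null[OF N] show "N \<in> null_sets (distr lebesgue lborel T)"
        by (auto simp: null_sets_def emeasure_distr)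
    qed
  qed
  moreover have "(\<integral>\<^sup>+x. g (T x) \<partial>lebesgue) = c * (\<integral>\<^sup>+x. g x \<partial>lebesgue)"
    if g: "g \<in> borel_measurable lebesgue" for g :: "'a \<Rightarrow> ennreal"
  proof -
    obtain h where h[measurable]: "h \<in> borel_measurable lborel" and gh: "AE x in lborel. g x = h x"
      using completion_ex_borel_measurable[OF g] by blast
    obtain N where N: "{x. g x \<noteq> h x} \<subseteq> N" "N \<in> null_sets lborel"
      using gh by (elim AE_E) (simp add: null_sets_def)
    have "AE x in lborel. g (T x) = h (T x)"
      by (rule AE_I'[OF null[OF N(2)]]) (use N(1) in auto)
    then have "(\<integral>\<^sup>+x. g (T x) \<partial>lebesgue) = (\<integral>\<^sup>+x. h (T x) \<partial>lborel)"
      by (simp add: nn_integral_completion cong: nn_integral_cong_AE)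
    also have "\<dots> = c * (\<integral>\<^sup>+x. h x \<partial>lborel)"
      by (rule c(2)) (use h in simp)
    also have "(\<integral>\<^sup>+x. h x \<partial>lborel) = (\<integral>\<^sup>+x. g x \<partial>lebesgue)"
      using gh by (simp add: nn_integral_completion cong: nn_integral_cong_AE)
    finally show ?thesis .
  qed
  ultimately show thesis using c(1) that by blast
qed

section \<open>Averages over cubes\<close>

lemma ennreal_less_divide_iff:
  "0 \<le> l \<Longrightarrow> 0 < b \<Longrightarrow> ennreal l < x / ennreal b \<longleftrightarrow> ennreal (l * b) < x"
  by (cases x) (auto simp: divide_ennreal ennreal_less_iff field_simps ennreal_top_divide)

lemma ennreal_le_divide_iff:
  "0 \<le> l \<Longrightarrow> 0 < b \<Longrightarrow> ennreal l \<le> x / ennreal b \<longleftrightarrow> ennreal (l * b) \<le> x"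
  by (cases x) (auto simp: divide_ennreal field_simps ennreal_top_divide)

text \<open>The closed ball of the maximum norm. With centre and half side as parameters, enlarging
  a cube about its centre changes a single number.\<close>

definition centered_cube :: "real^'n \<Rightarrow> real \<Rightarrow> (real^'n) set" where
  "centered_cube c r = cbox (\<chi> i. c $ i - r) (\<chi> i. c $ i + r)"

lemma mem_centered_cube: "x \<in> centered_cube c r \<longleftrightarrow> (\<forall>i. \<bar>x $ i - c $ i\<bar> \<le> r)"
  by (auto simp: centered_cube_def mem_box_cart abs_le_iff algebra_simps)

lemma centered_cube_mono:
  assumes "r \<le> t" shows "centered_cube c r \<subseteq> centered_cube c t"
proof
  fix x assume "x \<in> centered_cube c r"
  then have "\<bar>x $ i - c $ i\<bar> \<le> r" for i by (simp add: mem_centered_cube)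
  from order_trans[OF this assms] show "x \<in> centered_cube c t" by (simp add: mem_centered_cube)
qed

lemma cubes_eq: "cubes = {centered_cube c r |c r. 0 < r}"
proof (intro equalityI subsetI)
  fix Q :: "(real^'n) set" assume "Q \<in> cubes"
  then obtain a b l where Q: "Q = cbox a b" "0 < l" "\<And>i. b $ i = a $ i + l"
    by (auto simp: cubes_def)
  have "Q = centered_cube (\<chi> i. a $ i + l / 2) (l / 2)"
    unfolding centered_cube_def Q(1) by (rule arg_cong2[where f=cbox]) (simp_all add: vec_eq_iff Q(3))
  then show "Q \<in> {centered_cube c r |c r. 0 < r}"
    using Q(2) half_gt_zero by blast
next
  fix Q :: "(real^'n) set" assume "Q \<in> {centered_cube c r |c r. 0 < r}"
  then obtain c r where Q: "Q = centered_cube c r" "0 < r" by blast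
  show "Q \<in> cubes"
    unfolding cubes_def Q(1) centered_cube_def mem_Collect_eq using Q(2)
    by (intro exI[of _ "2 * r"] exI[of _ "\<chi> i. c $ i - r"] exI[of _ "\<chi> i. c $ i + r"] conjI refl) auto
qed

lemma centered_cube_in_cubes: "0 < r \<Longrightarrow> centered_cube c r \<in> cubes"
  by (auto simp: cubes_eq)

lemma sets_centered_cube [measurable]:
  "centered_cube c r \<in> sets borel" "centered_cube c r \<in> sets lebesgue"
  by (simp_all add: centered_cube_def)

lemma sets_cubes: "Q \<in> cubes \<Longrightarrow> Q \<in> sets lebesgue"
  by (auto simp: cubes_def)

lemma emeasure_centered_cube:
  fixes c :: "real^'n"
  assumes "0 < r"
  shows "emeasure lebesgue (centered_cube c r) = ennreal ((2 * r) ^ CARD('n))"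
proof -
  have "cbox (\<chi> i. c $ i - r) (\<chi> i. c $ i + r) \<noteq> {}"
    using assms by (auto simp: interval_ne_empty_cart)
  then have "measure lborel (centered_cube c r) = (2 * r) ^ CARD('n)"
    by (simp add: centered_cube_def content_cbox_cart)
  moreover have "emeasure lborel (centered_cube c r) = ennreal (measure lborel (centered_cube c r))"
    unfolding centered_cube_def
    using emeasure_lborel_cbox_finite by (intro emeasure_eq_ennreal_measure) (auto simp: less_top)
  ultimately show ?thesis by simp
qed

lemma emeasure_cubes:
  fixes Q :: "(real^'n) set"
  assumes "Q \<in> cubes"
  shows "emeasure lebesgue Q \<noteq> 0" "emeasure lebesgue Q \<noteq> top"
proof -
  obtain c r where "0 < r" "Q = centered_cube c r"
    using assms by (auto simp: cubes_eq)
  moreover from this have "0 < (2 * r) ^ CARD('n)"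
    by simp
  ultimately show "emeasure lebesgue Q \<noteq> 0" "emeasure lebesgue Q \<noteq> top"
    by (simp_all only: emeasure_centered_cube ennreal_eq_0_iff not_le ennreal_neq_top not_False_eq_True)
qed

text \<open>Normalized Lebesgue measure on a cube is a probability measure, so Hoelder's inequality
  for general measures applies to averages without volume factors.\<close>

lemma avg_eq_uniform_measure:
  assumes "Q \<in> cubes" "g \<in> borel_measurable lebesgue"
  shows "avg Q g = (\<integral>\<^sup>+x. ennreal (g x) \<partial>uniform_measure lebesgue Q)"
  using assms sets_cubes[OF assms(1)] by (subst nn_integral_uniform_measure) (auto simp: avg_def)

lemma avg_mono:
  "(\<And>x. x \<in> Q \<Longrightarrow> g x \<le> h x) \<Longrightarrow> avg Q g \<le> avg Q h"
  unfolding avg_def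
  by (intro divide_right_mono_ennreal nn_integral_mono) (auto simp: indicator_def intro: ennreal_leI)

text \<open>Hoelder's inequality for the splitting of \<open>\<bar>f x\<bar>\<close> into
  \<open>\<bar>f x\<bar> * w x powr (1 / q)\<close> and \<open>w x powr (- 1 / q)\<close>, valid
  where \<open>w\<close> is positive.\<close>

lemma avg_weighted_Holder:
  fixes w f :: "real^'n \<Rightarrow> real"
  assumes q: "1 < q" and Q: "Q \<in> cubes"
    and [measurable]: "w \<in> borel_measurable lebesgue" "f \<in> borel_measurable lebesgue"
    and pos: "AE x in lebesgue. 0 < w x"
  shows "epowr (avg Q (\<lambda>x. \<bar>f x\<bar>)) q
    \<le> avg Q (\<lambda>x. \<bar>f x\<bar> powr q * w x) * epowr (avg Q (\<lambda>x. w x powr (- 1 / (q - 1)))) (q - 1)"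
proof -
  let ?U = "uniform_measure lebesgue Q"
  let ?F = "\<lambda>x. \<bar>f x\<bar> * w x powr (1 / q)" and ?G = "\<lambda>x. w x powr (- 1 / q)"
  have [measurable]: "Q \<in> sets lebesgue" using Q by (rule sets_cubes)
  have U: "AE x in ?U. 0 < w x"
    using pos by (intro AE_uniform_measureI) auto
  have "avg Q (\<lambda>x. \<bar>f x\<bar>) = (\<integral>\<^sup>+x. ennreal \<bar>f x\<bar> \<partial>?U)"
    using Q by (subst avg_eq_uniform_measure) auto
  also have "\<dots> = (\<integral>\<^sup>+x. ennreal (?F x * ?G x) \<partial>?U)"
    by (rule nn_integral_cong_AE) (use U in \<open>eventually_elim, simp add: mult.assoc flip: powr_add\<close>)
  finally have 1: "avg Q (\<lambda>x. \<bar>f x\<bar>) = \<dots>" .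
  have "avg Q (\<lambda>x. \<bar>f x\<bar> powr q * w x) = (\<integral>\<^sup>+x. ennreal (\<bar>f x\<bar> powr q * w x) \<partial>?U)"
    using Q by (subst avg_eq_uniform_measure) auto
  also have "\<dots> = (\<integral>\<^sup>+x. ennreal (?F x powr q) \<partial>?U)"
    by (rule nn_integral_cong_AE) (use U in \<open>eventually_elim, use q in \<open>simp add: powr_mult powr_powr\<close>\<close>)
  finally have 2: "avg Q (\<lambda>x. \<bar>f x\<bar> powr q * w x) = \<dots>" .
  have "avg Q (\<lambda>x. w x powr (- 1 / (q - 1))) = (\<integral>\<^sup>+x. ennreal (w x powr (- 1 / (q - 1))) \<partial>?U)"
    using Q by (subst avg_eq_uniform_measure) auto
  also have "\<dots> = (\<integral>\<^sup>+x. ennreal (?G x powr (q / (q - 1))) \<partial>?U)"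
    using q by (simp add: powr_powr)
  finally have 3: "avg Q (\<lambda>x. w x powr (- 1 / (q - 1))) = \<dots>" .
  show ?thesis
    unfolding 1 2 3 by (rule Holder_nn_integral) (use q in \<open>auto\<close>)
qed

text \<open>The two-weight A_q condition for the pair \<open>(v, w)\<close> in the form it takes
  after Hoelder's inequality. The covering argument uses it in this form, in which negative powers
  of \<open>w\<close> no longer occur.\<close>

definition testing :: "real \<Rightarrow> real \<Rightarrow> (real^'n \<Rightarrow> real) \<Rightarrow> (real^'n \<Rightarrow> real) \<Rightarrow> bool" where
  "testing K q v w \<longleftrightarrow> (\<forall>Q\<in>cubes. \<forall>f\<in>borel_measurable lebesgue.
     avg Q v * epowr (avg Q (\<lambda>x. \<bar>f x\<bar>)) q \<le> ennreal K * avg Q (\<lambda>x. \<bar>f x\<bar> powr q * w x))"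

text \<open>Testing on \<open>f\<close> restricted to the small cube puts the enlarged cube on the left while only
  the small one appears on the right; this replaces a doubling property of \<open>v\<close>.\<close>

lemma testing_enlarge:
  fixes v w f :: "real^'n \<Rightarrow> real"
  assumes test: "testing K q v w" and q: "0 < q" and K: "0 \<le> K"
    and [measurable]: "v \<in> borel_measurable lebesgue" "w \<in> borel_measurable lebesgue" "f \<in> borel_measurable lebesgue"
    and r: "0 < r" and D: "1 \<le> D" and l: "0 \<le> l" "ennreal l < avg (centered_cube c r) (\<lambda>x. \<bar>f x\<bar>)"
  shows "(\<integral>\<^sup>+x\<in>centered_cube c (D * r). ennreal (v x) \<partial>lebesgue) * ennreal (l powr q)
    \<le> ennreal (K * (D ^ CARD('n)) powr q) * (\<integral>\<^sup>+x\<in>centered_cube c r. ennreal (\<bar>f x\<bar> powr q * w x) \<partial>lebesgue)"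
proof -
  let ?P = "centered_cube c r" and ?Q = "centered_cube c (D * r)" and ?n = "CARD('n)"
  define g where "g = (\<lambda>x. f x * indicator ?P x)"
  have sub: "?P \<subseteq> ?Q"
    using D r mult_right_mono[of 1 D r] by (intro centered_cube_mono) simp
  have "\<bar>g x\<bar> = \<bar>f x\<bar> * indicator ?P x" "\<bar>g x\<bar> powr q * w x = \<bar>f x\<bar> powr q * w x * indicator ?P x" for x
    using q by (auto simp: g_def indicator_def)
  note g = this
  have Dr: "0 < D * r" using D r by simp
  have restr: "(\<integral>\<^sup>+x\<in>?Q. ennreal (h x * indicator ?P x) \<partial>lebesgue) = (\<integral>\<^sup>+x\<in>?P. ennreal (h x) \<partial>lebesgue)" for h :: "real^'n \<Rightarrow> real"
    using sub by (intro nn_integral_cong) (auto simp: indicator_def)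
  define a where "a = (2 * r) ^ ?n"
  have a: "0 < a" using r by (simp add: a_def)
  have Dn: "1 \<le> D ^ ?n" using D by simp
  have eP: "emeasure lebesgue ?P = ennreal a"
    unfolding a_def by (rule emeasure_centered_cube[OF r])
  have "(2 * (D * r)) ^ ?n = D ^ ?n * a"
    by (simp add: a_def power_mult_distrib mult_ac)
  then have eQ: "emeasure lebesgue ?Q = ennreal (D ^ ?n * a)"
    using emeasure_centered_cube[OF Dr, of c] by (simp only:)
  have [measurable]: "g \<in> borel_measurable lebesgue"
    unfolding g_def by measurable
  \<comment> \<open>Spreading the mass of \<open>f\<close> on \<open>?P\<close> over
    \<open>?Q\<close> divides the average by the volume ratio \<open>D ^ ?n\<close>; this is the
    source of the power of \<open>D\<close> in the constant.\<close>
  have avgg: "ennreal (l / D ^ ?n) \<le> avg ?Q (\<lambda>x. \<bar>g x\<bar>)"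
  proof -
    have "ennreal (l * a) \<le> (\<integral>\<^sup>+x\<in>?P. ennreal \<bar>f x\<bar> \<partial>lebesgue)"
      using l a unfolding avg_def eP by (simp add: ennreal_less_divide_iff less_imp_le)
    moreover have "l / D ^ ?n * (D ^ ?n * a) = l * a"
      using D by simp
    ultimately show ?thesis
      using a Dn l unfolding avg_def eQ g restr by (subst ennreal_le_divide_iff) auto
  qed
  have "avg ?Q v * ennreal ((l / D ^ ?n) powr q) \<le> avg ?Q v * epowr (avg ?Q (\<lambda>x. \<bar>g x\<bar>)) q"
    using epowr_mono[OF _ avgg, of q] l q Dn by (intro mult_left_mono) (auto simp: epowr_ennreal)
  also have "\<dots> \<le> ennreal K * avg ?Q (\<lambda>x. \<bar>g x\<bar> powr q * w x)"
    using test centered_cube_in_cubes[OF Dr, of c] \<open>g \<in> borel_measurable lebesgue\<close>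
    unfolding testing_def by blast
  finally have le: "avg ?Q v * ennreal ((l / D ^ ?n) powr q) \<le> ennreal K * avg ?Q (\<lambda>x. \<bar>g x\<bar> powr q * w x)" .
  \<comment> \<open>Multiplying by the volume of \<open>?Q\<close> turns the averages on both sides
    into integrals; the support of \<open>g\<close> then reduces the right one to
    \<open>?P\<close>.\<close>
  have cancel: "(\<integral>\<^sup>+x\<in>?Q. ennreal (h x) \<partial>lebesgue) = ennreal (D ^ ?n * a) * avg ?Q h" for h
  proof -
    have "0 < D ^ ?n * a" using a Dn by simp
    then show ?thesis
      unfolding avg_def eQ ennreal_times_divide
      by (subst mult.commute) (simp add: ennreal_mult_divide_eq ennreal_eq_0_iff not_le)
  qed
  have pw: "ennreal (l powr q) = ennreal ((D ^ ?n) powr q) * ennreal ((l / D ^ ?n) powr q)"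
    using l Dn D by (simp add: powr_divide flip: ennreal_mult)
  have "(\<integral>\<^sup>+x\<in>?Q. ennreal (v x) \<partial>lebesgue) * ennreal (l powr q)
      = (ennreal (D ^ ?n * a) * ennreal ((D ^ ?n) powr q)) * (avg ?Q v * ennreal ((l / D ^ ?n) powr q))"
    unfolding cancel pw by (simp only: mult_ac)
  also have "\<dots> \<le> (ennreal (D ^ ?n * a) * ennreal ((D ^ ?n) powr q)) * (ennreal K * avg ?Q (\<lambda>x. \<bar>g x\<bar> powr q * w x))"
    using le by (rule mult_left_mono) simp
  also have "\<dots> = (ennreal K * ennreal ((D ^ ?n) powr q)) * (\<integral>\<^sup>+x\<in>?Q. ennreal (\<bar>g x\<bar> powr q * w x) \<partial>lebesgue)"
    unfolding cancel by (simp only: mult_ac)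
  also have "\<dots> = ennreal (K * (D ^ ?n) powr q) * (\<integral>\<^sup>+x\<in>?P. ennreal (\<bar>f x\<bar> powr q * w x) \<partial>lebesgue)"
    by (simp only: g(2) restr ennreal_mult[OF K powr_ge_zero])
  finally show ?thesis .
qed

section \<open>Weak type and strong type inequalities\<close>

text \<open>The level set of the maximal function built from cubes of half side below
  \<open>R\<close> only. The bound is there for the Vitali lemma, which requires bounded radii; its
  strictness leaves room to enlarge each cube.\<close>

definition truncated_level :: "(real^'n \<Rightarrow> real) \<Rightarrow> real \<Rightarrow> real \<Rightarrow> (real^'n) set" where
  "truncated_level f R l =
     (\<Union>(c, r)\<in>{(c, r). 0 < r \<and> r < R \<and> ennreal l < avg (centered_cube c r) (\<lambda>y. \<bar>f y\<bar>)}. centered_cube c r)"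

text \<open>The condition on the average is strict, so it survives a slight enlargement of the
  closed cube about its centre, and the enlarged cube contains a ball around every point of the
  original one.\<close>

lemma open_truncated_level:
  fixes f :: "real^'n \<Rightarrow> real"
  assumes l: "0 \<le> l"
  shows "open (truncated_level f R l)"
  unfolding open_contains_ball
proof
  fix x assume "x \<in> truncated_level f R l"
  then obtain c r where cr: "0 < r" "r < R" "x \<in> centered_cube c r"
      and avg: "ennreal l < avg (centered_cube c r) (\<lambda>y. \<bar>f y\<bar>)"
    by (auto simp: truncated_level_def)
  let ?n = "CARD('n)"
  define I where "I = (\<integral>\<^sup>+y\<in>centered_cube c r. ennreal \<bar>f y\<bar> \<partial>lebesgue)"
  have I: "ennreal (l * (2 * r) ^ ?n) < I"
    using avg cr l by (simp add: avg_def I_def emeasure_centered_cube ennreal_less_divide_iff del: emeasure_completion)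
  \<comment> \<open>The integral over the larger cube is at least \<open>I\<close>, so it suffices
    that its volume, continuous in the half side, stays small enough.\<close>
  obtain t where t: "r < t" "t < R" "ennreal (l * (2 * t) ^ ?n) < I"
  proof -
    have "((\<lambda>t. ennreal (l * (2 * t) ^ ?n)) \<longlongrightarrow> ennreal (l * (2 * r) ^ ?n)) (at_right r)"
      by (intro tendsto_intros)
    then have "\<forall>\<^sub>F t in at_right r. ennreal (l * (2 * t) ^ ?n) < I"
      using I by (rule order_tendstoD)
    moreover have "\<forall>\<^sub>F t in at_right r. t \<in> {r<..<R}"
      using cr(2) by (rule eventually_at_right_real)
    ultimately have "\<forall>\<^sub>F t in at_right r. r < t \<and> t < R \<and> ennreal (l * (2 * t) ^ ?n) < I"
      by eventually_elim auto
    then show ?thesis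
      using that eventually_happens[of _ "at_right r"] by (auto simp: trivial_limit_at_right_real)
  qed
  have "I \<le> (\<integral>\<^sup>+y\<in>centered_cube c t. ennreal \<bar>f y\<bar> \<partial>lebesgue)"
    unfolding I_def using centered_cube_mono[of r t c] t(1)
    by (intro nn_integral_mono mult_left_mono) (auto simp: indicator_def)
  with t(3) have "ennreal (l * (2 * t) ^ ?n) < (\<integral>\<^sup>+y\<in>centered_cube c t. ennreal \<bar>f y\<bar> \<partial>lebesgue)"
    by (rule less_le_trans)
  then have "ennreal l < avg (centered_cube c t) (\<lambda>y. \<bar>f y\<bar>)"
    using cr t l by (simp add: avg_def emeasure_centered_cube ennreal_less_divide_iff del: emeasure_completion)
  with cr t have "(c, t) \<in> {(c, r). 0 < r \<and> r < R \<and> ennreal l < avg (centered_cube c r) (\<lambda>y. \<bar>f y\<bar>)}"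
    by simp
  from UN_upper[OF this, of "\<lambda>(c, r). centered_cube c r"]
  have "centered_cube c t \<subseteq> truncated_level f R l"
    unfolding truncated_level_def by simp
  moreover have "ball x (t - r) \<subseteq> centered_cube c t"
  proof
    fix y assume "y \<in> ball x (t - r)"
    then have 1: "\<bar>y $ i - x $ i\<bar> \<le> t - r" for i
      using component_le_norm_cart[of "y - x" i] by (simp add: dist_norm norm_minus_commute)
    have 2: "\<bar>x $ i - c $ i\<bar> \<le> r" for i
      using cr(3) by (simp add: mem_centered_cube)
    have "\<bar>y $ i - c $ i\<bar> \<le> t" for i
      using 1[of i] 2[of i] by linarith
    then show "y \<in> centered_cube c t"
      by (simp add: mem_centered_cube)
  qed
  ultimately have "ball x (t - r) \<subseteq> truncated_level f R l"
    by (rule subset_trans[rotated])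
  then show "\<exists>e>0. ball x e \<subseteq> truncated_level f R l"
    using t(1) by (intro exI[of _ "t - r"]) simp
qed

text \<open>The factor \<open>CARD('n)\<close> comes from bounding the Euclidean norm by the sum of
  the absolute values of the coordinates.\<close>

lemma centered_cube_subset_cball:
  fixes c :: "real^'n" and r :: real
  assumes "0 < r"
  shows "centered_cube c r \<subseteq> cball c (CARD('n) * r)"
proof
  fix x assume "x \<in> centered_cube c r"
  then have "\<bar>(x - c) $ i\<bar> \<le> r" for i
    by (simp add: mem_centered_cube)
  then have "norm (x - c) \<le> (\<Sum>i\<in>(UNIV :: 'n set). r)"
    by (intro order_trans[OF norm_le_l1_cart] sum_mono)
  then show "x \<in> cball c (CARD('n) * r)"
    by (simp add: dist_norm norm_minus_commute)
qed

lemma cball_subset_centered_cube: "cball c r \<subseteq> centered_cube c r"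
proof
  fix x assume "x \<in> cball c r"
  then have "norm (x - c) \<le> r" by (simp add: dist_norm norm_minus_commute)
  from order_trans[OF component_le_norm_cart this]
  have "\<bar>(x - c) $ i\<bar> \<le> r" for i .
  then show "x \<in> centered_cube c r" by (simp add: mem_centered_cube)
qed

text \<open>The Vitali lemma of the library selects Euclidean balls, here the balls \<open>B\<close> circumscribed about
  the cubes \<open>P\<close>; the cubes \<open>Q\<close> contain the fivefold dilations of these balls.\<close>

lemma weak_type_truncated:
  fixes v w f :: "real^'n \<Rightarrow> real"
  assumes test: "testing K q v w" and q: "0 < q" and K: "0 \<le> K"
    and [measurable]: "v \<in> borel_measurable lebesgue" "w \<in> borel_measurable lebesgue" "f \<in> borel_measurable lebesgue"
    and l: "0 \<le> l"
  shows "emeasure (density lebesgue (\<lambda>x. ennreal (v x))) (truncated_level f R l) * ennreal (l powr q)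
    \<le> ennreal (K * ((5 * real CARD('n)) ^ CARD('n)) powr q) * (\<integral>\<^sup>+x. ennreal (\<bar>f x\<bar> powr q * w x) \<partial>lebesgue)"
proof -
  let ?n = "real CARD('n)" and ?\<mu> = "density lebesgue (\<lambda>x. ennreal (v x))"
  let ?g = "\<lambda>x. ennreal (\<bar>f x\<bar> powr q * w x)"
  define J where "J = {(c, r). 0 < r \<and> r < R \<and> ennreal l < avg (centered_cube c r) (\<lambda>y. \<bar>f y\<bar>)}"
  define P Q B where "P = (\<lambda>(c :: real^'n, r). centered_cube c r)"
    and "Q = (\<lambda>(c :: real^'n, r). centered_cube c ((5 * ?n) * r))"
    and "B = (\<lambda>(c :: real^'n, r). cball c (?n * r))"
  \<comment> \<open>Positive and uniformly bounded radii, as the covering lemma demands; the bound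
    comes from the truncation at \<open>R\<close>.\<close>
  have "0 < ?n * snd j \<and> ?n * snd j \<le> ?n * R" if "j \<in> J" for j :: "(real^'n) \<times> real"
    using that by (auto simp: J_def)
  then obtain C where C: "countable C" "C \<subseteq> J"
      and disj: "pairwise (\<lambda>i j. disjnt (B i) (B j)) C"
      and cover: "\<And>i. i \<in> J \<Longrightarrow> \<exists>j. j \<in> C \<and> \<not> disjnt (B i) (B j) \<and> B i \<subseteq> ball (fst j) (5 * (?n * snd j))"
    unfolding B_def case_prod_unfold
    by (rule Vitali_covering_lemma_cballs_balls[of J "\<lambda>j. ?n * snd j" "?n * R" fst]) blast+
  have PB: "P j \<subseteq> B j" if "j \<in> J" for j
    using that centered_cube_subset_cball[of "snd j" "fst j"]
    by (simp add: J_def P_def B_def case_prod_unfold)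
  have sub: "truncated_level f R l \<subseteq> (\<Union>j\<in>C. Q j)"
  proof
    fix x assume "x \<in> truncated_level f R l"
    then obtain i where i: "i \<in> J" "x \<in> P i"
      unfolding truncated_level_def J_def[symmetric] P_def[symmetric] by blast
    then obtain j where j: "j \<in> C" "x \<in> ball (fst j) (5 * (?n * snd j))"
      using cover PB by blast
    then have "x \<in> cball (fst j) (5 * ?n * snd j)"
      by (simp add: mult.assoc)
    then have "x \<in> Q j"
      using cball_subset_centered_cube[of "fst j" "5 * ?n * snd j"] by (auto simp: Q_def case_prod_unfold)
    with j(1) show "x \<in> (\<Union>j\<in>C. Q j)" by blast
  qed
  have djP: "disjoint_family_on P C"
  proof (unfold disjoint_family_on_def, intro ballI impI)
    fix i j assume "i \<in> C" "j \<in> C" "i \<noteq> j"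
    then show "P i \<inter> P j = {}"
      using disj PB[of i] PB[of j] C(2) unfolding pairwise_def disjnt_def by blast
  qed
  have [measurable]: "P j \<in> sets lebesgue" "Q j \<in> sets lebesgue" for j
    by (auto simp: P_def Q_def case_prod_unfold)
  have "emeasure ?\<mu> (truncated_level f R l) \<le> emeasure ?\<mu> (\<Union>j\<in>C. Q j)"
    using sub C(1) by (intro emeasure_mono) (auto intro!: sets.countable_UN')
  also have "\<dots> \<le> (\<integral>\<^sup>+j. emeasure ?\<mu> (Q j) \<partial>count_space C)"
  \<comment> \<open>Countable subadditivity, by exchanging the integral over the countable index set
    with the one against \<open>?\<mu>\<close>.\<close>
  proof -
    have "emeasure ?\<mu> (\<Union>j\<in>C. Q j) = (\<integral>\<^sup>+x. indicator (\<Union>j\<in>C. Q j) x \<partial>?\<mu>)"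
      using C(1) by (intro nn_integral_indicator[symmetric]) (auto intro!: sets.countable_UN')
    also have "\<dots> \<le> (\<integral>\<^sup>+x. \<integral>\<^sup>+j. indicator (Q j) x \<partial>count_space C \<partial>?\<mu>)"
    proof (rule nn_integral_mono)
      fix x
      show "indicator (\<Union>j\<in>C. Q j) x \<le> (\<integral>\<^sup>+j. indicator (Q j) x \<partial>count_space C)"
      proof (cases "x \<in> (\<Union>j\<in>C. Q j)")
        case True
        then obtain j where j: "j \<in> C" "x \<in> Q j" by blast
        then have "1 \<le> (\<integral>\<^sup>+j. indicator (Q j) x \<partial>count_space C)"
          using nn_integral_ge_point[of j C "\<lambda>j. indicator (Q j) x"] by simp
        with True show ?thesis by (simp only: indicator_simps)
      qed simp
    qed
    also have "\<dots> = (\<integral>\<^sup>+j. \<integral>\<^sup>+x. indicator (Q j) x \<partial>?\<mu> \<partial>count_space C)"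
      using C(1) by (intro nn_integral_count_space_nn_integral) auto
    finally show ?thesis by (simp cong: nn_integral_cong)
  qed
  finally have "emeasure ?\<mu> (truncated_level f R l) * ennreal (l powr q)
      \<le> (\<integral>\<^sup>+j. emeasure ?\<mu> (Q j) \<partial>count_space C) * ennreal (l powr q)"
    by (rule mult_right_mono) simp
  also have "\<dots> = (\<integral>\<^sup>+j. emeasure ?\<mu> (Q j) * ennreal (l powr q) \<partial>count_space C)"
    by (simp add: nn_integral_multc)
  also have "\<dots> \<le> (\<integral>\<^sup>+j. ennreal (K * ((5 * ?n) ^ CARD('n)) powr q) * emeasure (density lebesgue ?g) (P j) \<partial>count_space C)"
  proof (rule nn_integral_mono)
    fix j assume "j \<in> space (count_space C)"
    then have "j \<in> J" using C by auto
    moreover obtain c r where j: "j = (c, r)" by (cases j)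
    ultimately have cr: "0 < r" "ennreal l < avg (centered_cube c r) (\<lambda>y. \<bar>f y\<bar>)"
      by (auto simp: J_def)
    have "1 \<le> 5 * ?n"
      using one_le_card_finite[where 'a='n] by linarith
    \<comment> \<open>The dilation is \<open>D = 5 * ?n\<close>: the factor \<open>5\<close> belongs
      to the covering lemma, the factor \<open>?n\<close> to the circumscribed ball.\<close>
    from testing_enlarge[OF test q K _ _ _ cr(1) this l cr(2)]
    show "emeasure ?\<mu> (Q j) * ennreal (l powr q)
      \<le> ennreal (K * ((5 * ?n) ^ CARD('n)) powr q) * emeasure (density lebesgue ?g) (P j)"
      by (simp add: P_def Q_def j emeasure_density)
  qed
  also have "\<dots> = ennreal (K * ((5 * ?n) ^ CARD('n)) powr q) * (\<integral>\<^sup>+j. emeasure (density lebesgue ?g) (P j) \<partial>count_space C)"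
    by (simp add: nn_integral_cmult)
  \<comment> \<open>Disjointness of the cubes \<open>P\<close> enters here: the local integrals add
    up to at most the integral over the whole space.\<close>
  also have "(\<integral>\<^sup>+j. emeasure (density lebesgue ?g) (P j) \<partial>count_space C) = emeasure (density lebesgue ?g) (\<Union>j\<in>C. P j)"
    using C(1) djP by (intro emeasure_UN_countable[symmetric]) auto
  also have "\<dots> \<le> emeasure (density lebesgue ?g) UNIV"
    by (intro emeasure_mono) auto
  also have "\<dots> = (\<integral>\<^sup>+x. ?g x \<partial>lebesgue)"
    by (subst emeasure_density) auto
  finally show ?thesis by (simp add: mult_left_mono)
qed

section \<open>Measurability and weak type bound of the full maximal function\<close>

lemma less_maximal_iff:
  fixes f :: "real^'n \<Rightarrow> real"
  shows "{x. ennreal l < maximal f x} = (\<Union>N::nat. truncated_level f (real N) l)"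
proof (intro equalityI subsetI)
  fix x assume "x \<in> {x. ennreal l < maximal f x}"
  then obtain Q where "Q \<in> cubes" "x \<in> Q" "ennreal l < avg Q (\<lambda>y. \<bar>f y\<bar>)"
    by (auto simp: maximal_def less_SUP_iff)
  then obtain c r where cr: "0 < r" "x \<in> centered_cube c r" "ennreal l < avg (centered_cube c r) (\<lambda>y. \<bar>f y\<bar>)"
    by (auto simp: cubes_eq)
  obtain N :: nat where N: "r < real N" using reals_Archimedean2 by blast
  have "x \<in> truncated_level f (real N) l"
    unfolding truncated_level_def by (rule UN_I[of "(c, r)"]) (use cr N in auto)
  then show "x \<in> (\<Union>N::nat. truncated_level f (real N) l)" by blast
next
  fix x assume "x \<in> (\<Union>N::nat. truncated_level f (real N) l)"
  then obtain c r where cr: "0 < r" "x \<in> centered_cube c r" "ennreal l < avg (centered_cube c r) (\<lambda>y. \<bar>f y\<bar>)"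
    unfolding truncated_level_def by blast
  then show "x \<in> {x. ennreal l < maximal f x}"
    unfolding maximal_def less_SUP_iff mem_Collect_eq
    by (intro bexI[of _ "centered_cube c r"]) (auto intro: centered_cube_in_cubes)
qed

lemma open_less_maximal: "0 \<le> l \<Longrightarrow> open {x. ennreal l < maximal f x}"
  unfolding less_maximal_iff by (intro open_UN ballI open_truncated_level)

text \<open>The maximal function is lower semicontinuous: its sets above finite levels are open, and
  the set above \<open>top\<close> is empty.\<close>

lemma borel_measurable_maximal [measurable]: "maximal f \<in> borel_measurable borel"
proof (rule borel_measurableI_greater)
  fix y
  show "{x \<in> space borel. y < maximal f x} \<in> sets borel"
    using open_less_maximal[of "enn2real y" f]
    by (cases "y = top") (auto simp: less_top intro!: borel_open)
qed

text \<open>The constant in the truncated inequality does not depend on \<open>R\<close>, so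
  continuity of the measure from below carries the inequality over to all cubes.\<close>

lemma weak_type_maximal:
  fixes v w f :: "real^'n \<Rightarrow> real"
  assumes "testing K q v w" "0 < q" "0 \<le> K"
    and [measurable]: "v \<in> borel_measurable lebesgue" "w \<in> borel_measurable lebesgue" "f \<in> borel_measurable lebesgue"
    and l: "0 \<le> l"
  shows "emeasure (density lebesgue (\<lambda>x. ennreal (v x))) {x. ennreal l < maximal f x} * ennreal (l powr q)
    \<le> ennreal (K * ((5 * real CARD('n)) ^ CARD('n)) powr q) * (\<integral>\<^sup>+x. ennreal (\<bar>f x\<bar> powr q * w x) \<partial>lebesgue)"
proof -
  let ?\<mu> = "density lebesgue (\<lambda>x. ennreal (v x))"
  have inc: "incseq (\<lambda>N::nat. truncated_level f (real N) l)"
    unfolding incseq_def truncated_level_def by (intro allI impI UN_mono) auto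
  have "open (truncated_level f R l)" for R
    using l by (rule open_truncated_level)
  then have "range (\<lambda>N::nat. truncated_level f (real N) l) \<subseteq> sets ?\<mu>"
    by (auto simp: borel_open)
  then have "emeasure ?\<mu> {x. ennreal l < maximal f x} = (SUP N::nat. emeasure ?\<mu> (truncated_level f (real N) l))"
    unfolding less_maximal_iff by (intro SUP_emeasure_incseq[symmetric] inc)
  then show ?thesis
    using weak_type_truncated[OF assms] by (auto simp: SUP_mult_right_ennreal intro!: SUP_least)
qed

text \<open>The part of \<open>f\<close> bounded by \<open>t / 2\<close> contributes at most
  \<open>t / 2\<close> to any average. This is the bound on L-infinity used as the second endpoint
  of the interpolation.\<close>

lemma less_maximal_truncate:
  fixes f :: "real^'n \<Rightarrow> real"
  assumes [measurable]: "f \<in> borel_measurable lebesgue" and t: "0 < t" "ennreal t < maximal f x"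
  shows "ennreal (t / 2) < maximal (\<lambda>y. if t / 2 < \<bar>f y\<bar> then f y else 0) x"
proof -
  let ?g = "\<lambda>y. if t / 2 < \<bar>f y\<bar> then f y else 0"
  obtain Q where Q: "Q \<in> cubes" "x \<in> Q" "ennreal t < avg Q (\<lambda>y. \<bar>f y\<bar>)"
    using t(2) by (auto simp: maximal_def less_SUP_iff)
  have [measurable]: "Q \<in> sets lebesgue" using Q(1) by (rule sets_cubes)
  have one: "emeasure (uniform_measure lebesgue Q) UNIV = 1"
    using emeasure_cubes[OF Q(1)] by (subst emeasure_uniform_measure) (auto simp: less_top ennreal_divide_self)
  have "avg Q (\<lambda>y. \<bar>f y\<bar>) \<le> avg Q (\<lambda>y. \<bar>?g y\<bar> + t / 2)"
    using t by (intro avg_mono) auto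
  also have "\<dots> = avg Q (\<lambda>y. \<bar>?g y\<bar>) + ennreal (t / 2)"
    using Q(1) t one by (simp add: avg_eq_uniform_measure nn_integral_add)
  finally have "ennreal t < avg Q (\<lambda>y. \<bar>?g y\<bar>) + ennreal (t / 2)"
    using Q(3) by (rule less_le_trans[rotated])
  then have "ennreal (t / 2) < avg Q (\<lambda>y. \<bar>?g y\<bar>)"
    using t by (cases "avg Q (\<lambda>y. \<bar>?g y\<bar>)") (auto simp: ennreal_less_iff simp flip: ennreal_plus)
  also have "\<dots> \<le> maximal ?g x"
    unfolding maximal_def using Q by (intro SUP_upper) auto
  finally show ?thesis .
qed

section \<open>Layer cake formula and Marcinkiewicz interpolation\<close>

lemma nn_integral_powr_Ioo:
  fixes a c :: real
  assumes "- 1 < a" "0 \<le> c"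
  shows "(\<integral>\<^sup>+t\<in>{0<..<c}. ennreal (t powr a) \<partial>lborel) = ennreal (c powr (a + 1) / (a + 1))"
  using has_integral_powr_from_0[OF assms]
  by (intro nn_integral_has_integral_lebesgue') (auto simp: has_integral_Icc_iff_Ioo)

text \<open>For finite \<open>X\<close> this is the integral of \<open>p * t powr (p - 1)\<close>
  over the interval from \<open>0\<close> to \<open>X\<close>, with equality. For
  \<open>X = top\<close> the right side dominates every finite instance and is therefore
  infinite.\<close>

lemma epowr_le_layer_cake:
  assumes p: "0 < p"
  shows "epowr X p \<le> (\<integral>\<^sup>+t. (if 0 < t \<and> ennreal t < X then ennreal (p * t powr (p - 1)) else 0) \<partial>lborel)"
    (is "_ \<le> ?I X")
proof -
  have real: "epowr (ennreal x) p = ?I (ennreal x)" if "0 \<le> x" for x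
  proof -
    have "?I (ennreal x) = (\<integral>\<^sup>+t. ennreal p * (ennreal (t powr (p - 1)) * indicator {0<..<x} t) \<partial>lborel)"
      using p by (intro nn_integral_cong) (auto simp: indicator_def ennreal_less_iff ennreal_mult)
    also have "\<dots> = ennreal p * ennreal (x powr p / p)"
      using p that by (subst nn_integral_cmult) (auto simp: nn_integral_powr_Ioo)
    also have "\<dots> = epowr (ennreal x) p"
      using p that by (simp add: epowr_ennreal flip: ennreal_mult)
    finally show ?thesis by simp
  qed
  show ?thesis
  proof (cases X)
    case top
    have "ennreal (real n) \<le> ?I X" for n
    proof -
      have "ennreal (real n) = epowr (ennreal (real n powr (1 / p))) p"
        using p by (simp add: epowr_ennreal powr_powr)
      also have "\<dots> = ?I (ennreal (real n powr (1 / p)))"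
        by (rule real) simp
      also have "\<dots> \<le> ?I X"
        by (intro nn_integral_mono) (auto simp: top)
      finally show ?thesis .
    qed
    then have "\<not> ?I X < top"
      using ennreal_Ex_less_of_nat[of "?I X"] by (auto simp: ennreal_of_nat_eq_real_of_nat not_less[symmetric])
    then have "?I X = top" using less_top by blast
    then show ?thesis by simp
  qed (simp add: real)
qed

text \<open>Serves the exchange of integrals below, where the space variable is integrated against
  the completed measure. A cover for \<open>lborel\<close> still works, since completion preserves
  the measure of Borel sets.\<close>

lemma sigma_finite_lebesgue: "sigma_finite_measure lebesgue"
proof -
  obtain A :: "'a set set" where "countable A" "A \<subseteq> sets lborel" "\<Union>A = space lborel"
      "\<forall>a\<in>A. emeasure lborel a \<noteq> \<infinity>"
    using lborel.sigma_finite_countable by blast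
  then show ?thesis
    by (intro sigma_finite_measure.intro exI[of _ A]) auto
qed

text \<open>Marcinkiewicz interpolation: the layer cake formula, the weak type inequality at level
  \<open>t / 2\<close> for the part of \<open>f\<close> above \<open>t / 2\<close>, and an exchange
  of integrals. What remains is the integral of \<open>t powr (p - q - 1)\<close> up to
  \<open>2 * \<bar>f x\<bar>\<close>, which converges at \<open>0\<close> because
  \<open>q < p\<close>.\<close>

lemma maximal_strong_type:
  fixes v w :: "real^'n \<Rightarrow> real"
  assumes test: "testing K q v w" and q: "0 < q" "q < p" and K: "0 \<le> K"
    and [measurable]: "v \<in> borel_measurable lebesgue" "w \<in> borel_measurable lebesgue"
  obtains C :: real where
    "\<And>f. f \<in> borel_measurable lebesgue \<Longrightarrow> (\<integral>\<^sup>+x. epowr (maximal f x) p * ennreal (v x) \<partial>lebesgue)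
      \<le> ennreal C * (\<integral>\<^sup>+x. ennreal (\<bar>f x\<bar> powr p) * ennreal (w x) \<partial>lebesgue)"
proof
  \<comment> \<open>\<open>L\<close> is the weak type constant; the strong type constant obtained at
    the end is \<open>L * p * 2 powr p / (p - q)\<close>.\<close>
  define L where "L = K * ((5 * real CARD('n)) ^ CARD('n)) powr q"
  have L: "0 \<le> L" using K by (simp add: L_def)
  have p: "0 < p" using q by simp
  fix f :: "real^'n \<Rightarrow> real" assume [measurable]: "f \<in> borel_measurable lebesgue"
  let ?\<mu> = "density lebesgue (\<lambda>x. ennreal (v x))"
  let ?h = "\<lambda>t. ennreal (p * t powr (p - 1))"
  interpret lebesgue: sigma_finite_measure "lebesgue :: (real^'n) measure"
    by (rule sigma_finite_lebesgue)
  interpret pair_sigma_finite "lebesgue :: (real^'n) measure" "lborel :: real measure" ..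
  have [measurable]: "maximal f \<in> borel_measurable lebesgue"
    by (intro measurable_completion) simp
  have "(\<integral>\<^sup>+x. epowr (maximal f x) p * ennreal (v x) \<partial>lebesgue)
      \<le> (\<integral>\<^sup>+x. (\<integral>\<^sup>+t. (if 0 < t \<and> ennreal t < maximal f x then ?h t else 0) \<partial>lborel) * ennreal (v x) \<partial>lebesgue)"
    by (intro nn_integral_mono mult_right_mono epowr_le_layer_cake p) simp
  also have "\<dots> = (\<integral>\<^sup>+x. \<integral>\<^sup>+t. (if 0 < t \<and> ennreal t < maximal f x then ?h t else 0) * ennreal (v x) \<partial>lborel \<partial>lebesgue)"
    by (simp add: nn_integral_multc)
  also have "\<dots> = (\<integral>\<^sup>+t. \<integral>\<^sup>+x. (if 0 < t \<and> ennreal t < maximal f x then ?h t else 0) * ennreal (v x) \<partial>lebesgue \<partial>lborel)"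
    by (rule Fubini'[symmetric]) simp
  also have "\<dots> \<le> (\<integral>\<^sup>+t. \<integral>\<^sup>+x. (if 0 < t \<and> t < 2 * \<bar>f x\<bar> then ennreal (L * p * 2 powr q * t powr (p - q - 1)) else 0)
      * ennreal (\<bar>f x\<bar> powr q * w x) \<partial>lebesgue \<partial>lborel)"
  proof (rule nn_integral_mono)
    fix t :: real
    let ?g = "\<lambda>y. if t / 2 < \<bar>f y\<bar> then f y else 0"
    define E where "E = {x. ennreal (t / 2) < maximal ?g x}"
    show "(\<integral>\<^sup>+x. (if 0 < t \<and> ennreal t < maximal f x then ?h t else 0) * ennreal (v x) \<partial>lebesgue)
      \<le> (\<integral>\<^sup>+x. (if 0 < t \<and> t < 2 * \<bar>f x\<bar> then ennreal (L * p * 2 powr q * t powr (p - q - 1)) else 0)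
      * ennreal (\<bar>f x\<bar> powr q * w x) \<partial>lebesgue)"
    proof (cases "0 < t")
      case True
      then have "open E"
        unfolding E_def by (intro open_less_maximal) simp
      then have [measurable]: "E \<in> sets lebesgue"
        by (simp add: borel_open)
      \<comment> \<open>Isolates the factor \<open>(t / 2) powr q\<close> that accompanies the
        measure of \<open>E\<close> in the weak type inequality.\<close>
      have split: "p * t powr (p - 1) = p * 2 powr q * t powr (p - q - 1) * (t / 2) powr q"
        using True by (simp add: powr_divide flip: powr_add)
      \<comment> \<open>Since \<open>0 powr q = 0\<close>, the truncation becomes a cutoff in
        \<open>t\<close>, which turns into an upper limit of integration once the integrals are
        exchanged.\<close>
      have gq: "ennreal (\<bar>?g x\<bar> powr q * w x) = (if t < 2 * \<bar>f x\<bar> then 1 else 0) * ennreal (\<bar>f x\<bar> powr q * w x)" for x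
        using q by auto
      have "(\<integral>\<^sup>+x. (if 0 < t \<and> ennreal t < maximal f x then ?h t else 0) * ennreal (v x) \<partial>lebesgue)
        \<le> (\<integral>\<^sup>+x. ?h t * (ennreal (v x) * indicator E x) \<partial>lebesgue)"
        using True less_maximal_truncate[of f t] by (intro nn_integral_mono) (auto simp: indicator_def E_def)
      also have "\<dots> = ?h t * emeasure ?\<mu> E"
        by (subst nn_integral_cmult) (auto simp: emeasure_density)
      also have "\<dots> = ennreal (p * 2 powr q * t powr (p - q - 1)) *
          (emeasure ?\<mu> E * ennreal ((t / 2) powr q))"
        using p unfolding split by (subst ennreal_mult) (auto simp: mult_ac)
      also have "\<dots> \<le> ennreal (p * 2 powr q * t powr (p - q - 1)) *
          (ennreal L * (\<integral>\<^sup>+x. ennreal (\<bar>?g x\<bar> powr q * w x) \<partial>lebesgue))"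
        unfolding L_def E_def using True by (intro mult_left_mono weak_type_maximal test q K) auto
      also have "\<dots> = ennreal (L * p * 2 powr q * t powr (p - q - 1)) * (\<integral>\<^sup>+x. ennreal (\<bar>?g x\<bar> powr q * w x) \<partial>lebesgue)"
        using L p by (simp add: ennreal_mult mult_ac)
      also have "\<dots> = (\<integral>\<^sup>+x. ennreal (L * p * 2 powr q * t powr (p - q - 1)) * ennreal (\<bar>?g x\<bar> powr q * w x) \<partial>lebesgue)"
        by (subst nn_integral_cmult) auto
      also have "\<dots> = (\<integral>\<^sup>+x. (if 0 < t \<and> t < 2 * \<bar>f x\<bar> then ennreal (L * p * 2 powr q * t powr (p - q - 1)) else 0)
          * ennreal (\<bar>f x\<bar> powr q * w x) \<partial>lebesgue)"
        unfolding gq using True by (intro nn_integral_cong) auto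
      finally show ?thesis .
    qed simp
  qed
  also have "\<dots> = (\<integral>\<^sup>+x. \<integral>\<^sup>+t. (if 0 < t \<and> t < 2 * \<bar>f x\<bar> then ennreal (L * p * 2 powr q * t powr (p - q - 1)) else 0)
      * ennreal (\<bar>f x\<bar> powr q * w x) \<partial>lborel \<partial>lebesgue)"
    by (rule Fubini') simp
  also have "\<dots> = (\<integral>\<^sup>+x. ennreal (L * p * 2 powr p / (p - q)) * (ennreal (\<bar>f x\<bar> powr p) * ennreal (w x)) \<partial>lebesgue)"
  proof (rule nn_integral_cong)
    fix x
    have "(\<integral>\<^sup>+t. (if 0 < t \<and> t < 2 * \<bar>f x\<bar> then ennreal (L * p * 2 powr q * t powr (p - q - 1)) else 0)
        * ennreal (\<bar>f x\<bar> powr q * w x) \<partial>lborel)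
      = (\<integral>\<^sup>+t. ennreal (L * p * 2 powr q) * (ennreal (t powr (p - q - 1)) * indicator {0<..<2 * \<bar>f x\<bar>} t)
        * ennreal (\<bar>f x\<bar> powr q * w x) \<partial>lborel)"
      using L p by (intro nn_integral_cong) (auto simp: indicator_def ennreal_mult)
    also have "\<dots> = ennreal (L * p * 2 powr q) * ennreal ((2 * \<bar>f x\<bar>) powr (p - q) / (p - q))
        * ennreal (\<bar>f x\<bar> powr q * w x)"
      using q nn_integral_powr_Ioo[of "p - q - 1" "2 * \<bar>f x\<bar>"]
      by (simp add: nn_integral_multc nn_integral_cmult)
    also have "\<dots> = ennreal (L * p * 2 powr q * ((2 * \<bar>f x\<bar>) powr (p - q) / (p - q)) * \<bar>f x\<bar> powr q) * ennreal (w x)"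
    proof -
      have "0 \<le> L * p * 2 powr q" "0 \<le> (2 * \<bar>f x\<bar>) powr (p - q) / (p - q)"
        using L p q by auto
      \<comment> \<open>\<open>d\<close> stands for \<open>w x\<close>, whose sign is not known
        here, so only the nonnegative factors are moved across \<open>ennreal\<close>.\<close>
      moreover have "ennreal a * ennreal b * ennreal (c * d) = ennreal (a * b * c) * ennreal d"
        if "0 \<le> a" "0 \<le> b" "0 \<le> c" for a b c d
        using that by (simp add: ennreal_mult' mult.assoc)
      ultimately show ?thesis by simp
    qed
    also have "L * p * 2 powr q * ((2 * \<bar>f x\<bar>) powr (p - q) / (p - q)) * \<bar>f x\<bar> powr q
      = L * p * 2 powr p / (p - q) * \<bar>f x\<bar> powr p"
    proof -
      have "2 powr q * 2 powr (p - q) = (2::real) powr p" "\<bar>f x\<bar> powr (p - q) * \<bar>f x\<bar> powr q = \<bar>f x\<bar> powr p"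
        by (simp_all flip: powr_add)
      then show ?thesis
        by (simp add: powr_mult)
    qed
    also have "ennreal (L * p * 2 powr p / (p - q) * \<bar>f x\<bar> powr p) * ennreal (w x)
      = ennreal (L * p * 2 powr p / (p - q)) * (ennreal (\<bar>f x\<bar> powr p) * ennreal (w x))"
    proof -
      have "0 \<le> L * p * 2 powr p / (p - q)" using L p q by auto
      then show ?thesis by (simp only: ennreal_mult powr_ge_zero mult.assoc)
    qed
    finally show "(\<integral>\<^sup>+t. (if 0 < t \<and> t < 2 * \<bar>f x\<bar> then ennreal (L * p * 2 powr q * t powr (p - q - 1)) else 0)
        * ennreal (\<bar>f x\<bar> powr q * w x) \<partial>lborel) = \<dots>" .
  qed
  also have "\<dots> = ennreal (L * p * 2 powr p / (p - q)) * (\<integral>\<^sup>+x. ennreal (\<bar>f x\<bar> powr p) * ennreal (w x) \<partial>lebesgue)"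
    by (rule nn_integral_cmult) simp
  finally show "(\<integral>\<^sup>+x. epowr (maximal f x) p * ennreal (v x) \<partial>lebesgue)
      \<le> ennreal (L * p * 2 powr p / (p - q)) * (\<integral>\<^sup>+x. ennreal (\<bar>f x\<bar> powr p) * ennreal (w x) \<partial>lebesgue)" .
qed

section \<open>The theorem\<close>

text \<open>Local integrability gives measurability of the restrictions to balls, and these converge
  pointwise to \<open>w\<close>.\<close>

lemma borel_measurable_weight:
  fixes w :: "real^'n \<Rightarrow> real"
  assumes "weight w" shows "w \<in> borel_measurable lebesgue"
proof (rule borel_measurable_LIMSEQ_real)
  fix n :: nat
  have "set_integrable lebesgue (cball 0 (real n)) w"
    using assms by (auto simp: weight_def)
  then show "(\<lambda>x. indicator (cball 0 (real n)) x *\<^sub>R w x) \<in> borel_measurable lebesgue"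
    unfolding set_integrable_def by (rule borel_measurable_integrable)
next
  fix x :: "real^'n"
  obtain N :: nat where N: "norm x < real N" using reals_Archimedean2 by blast
  have "\<forall>\<^sub>F n in sequentially. indicator (cball 0 (real n)) x *\<^sub>R w x = w x"
    using eventually_ge_at_top[of N] by eventually_elim (use N in \<open>auto simp: indicator_def\<close>)
  then show "(\<lambda>n. indicator (cball 0 (real n)) x *\<^sub>R w x) \<longlonglongrightarrow> w x"
    by (rule tendsto_eventually)
qed

text \<open>The exponents fit together: \<open>1 - conj_exp p\<close> is
  \<open>- 1 / (p - 1)\<close>, and multiplied by \<open>(p - 1) / (q - 1)\<close> it becomes
  \<open>- 1 / (q - 1)\<close>. The reverse Hoelder inequality raised to the power
  \<open>p - 1\<close> therefore bounds the dual factor of the A_q condition by that of the A_p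
  condition.\<close>

lemma testing_of_reverse_Holder:
  fixes A :: "real^'n^'n" and w :: "real^'n \<Rightarrow> real"
  assumes q: "1 < q" and p: "1 < p" and Ap: "w \<in> Ap_class A p"
    and RH: "(\<lambda>x. w x powr (1 - conj_exp p)) \<in> RH_class ((p - 1) / (q - 1))"
  obtains K where "0 \<le> K" "testing K q (\<lambda>x. w (A *v x)) w"
proof -
  let ?v = "\<lambda>x. w (A *v x)" and ?s = "(p - 1) / (q - 1)"
  have w: "weight w" and fin: "Ap_const A p w < top"
    using Ap by (auto simp: Ap_class_def)
  have [measurable]: "w \<in> borel_measurable lebesgue" using w by (rule borel_measurable_weight)
  have pos: "AE x in lebesgue. 0 < w x" using w by (simp add: weight_def)
  have e: "1 - conj_exp p = - 1 / (p - 1)"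
    using p by (simp add: conj_exp_def field_simps)
  have "- 1 / (p - 1) * ?s = - 1 / (q - 1)"
    using p q by (simp add: field_simps)
  then have es: "(w x powr (- 1 / (p - 1))) powr ?s = w x powr (- 1 / (q - 1))" for x
    by (simp only: powr_powr)
  obtain C where C: "\<And>Q. Q \<in> cubes \<Longrightarrow> epowr (avg Q (\<lambda>x. w x powr (- 1 / (q - 1)))) (1 / ?s)
      \<le> ennreal C * avg Q (\<lambda>x. w x powr (- 1 / (p - 1)))"
    using RH by (simp only: RH_class_def mem_Collect_eq e es) blast
  \<comment> \<open>The \<open>(p - 1)\<close>-th power of the reverse Hoelder constant times the
    A_p constant of \<open>w\<close>; finite, hence a real number.\<close>
  define K where "K = enn2real (epowr (ennreal C) (p - 1) * Ap_const A p w)"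
  have K: "ennreal K = epowr (ennreal C) (p - 1) * Ap_const A p w"
    unfolding K_def using fin by (intro ennreal_enn2real) (simp add: ennreal_mult_less_top epowr_less_top)
  have "avg Q ?v * epowr (avg Q (\<lambda>x. \<bar>f x\<bar>)) q \<le> ennreal K * avg Q (\<lambda>x. \<bar>f x\<bar> powr q * w x)"
    if Q: "Q \<in> cubes" and f: "f \<in> borel_measurable lebesgue" for Q f
  proof -
    let ?\<sigma> = "avg Q (\<lambda>x. w x powr (- 1 / (p - 1)))" and ?\<tau> = "avg Q (\<lambda>x. w x powr (- 1 / (q - 1)))"
    have "epowr ?\<tau> (q - 1) = epowr (epowr ?\<tau> (1 / ?s)) (p - 1)"
      using p q by (simp add: epowr_epowr)
    also have "\<dots> \<le> epowr (ennreal C * ?\<sigma>) (p - 1)"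
      using p by (intro epowr_mono C Q) simp
    also have "\<dots> = epowr (ennreal C) (p - 1) * epowr ?\<sigma> (p - 1)"
      by (rule epowr_mult)
    finally have "avg Q ?v * epowr ?\<tau> (q - 1) \<le> avg Q ?v * (epowr (ennreal C) (p - 1) * epowr ?\<sigma> (p - 1))"
      by (rule mult_left_mono) simp
    also have "\<dots> = epowr (ennreal C) (p - 1) * (avg Q ?v * epowr ?\<sigma> (p - 1))"
      by (simp only: mult_ac)
    also have "\<dots> \<le> ennreal K"
      unfolding K Ap_const_def by (intro mult_left_mono SUP_upper Q) simp
    \<comment> \<open>This is the A_q condition for the pair \<open>(?v, w)\<close>; Hoelder's
      inequality now yields the testing inequality.\<close>
    finally have bump: "avg Q ?v * epowr ?\<tau> (q - 1) \<le> ennreal K" .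
    have "avg Q ?v * epowr (avg Q (\<lambda>x. \<bar>f x\<bar>)) q
        \<le> avg Q ?v * (avg Q (\<lambda>x. \<bar>f x\<bar> powr q * w x) * epowr ?\<tau> (q - 1))"
      using q Q f pos by (intro mult_left_mono avg_weighted_Holder) auto
    also have "\<dots> = (avg Q ?v * epowr ?\<tau> (q - 1)) * avg Q (\<lambda>x. \<bar>f x\<bar> powr q * w x)"
      by (simp only: mult_ac)
    also have "\<dots> \<le> ennreal K * avg Q (\<lambda>x. \<bar>f x\<bar> powr q * w x)"
      using bump by (rule mult_right_mono) simp
    finally show ?thesis .
  qed
  then have "testing K q ?v w"
    unfolding testing_def by blast
  then show thesis using that[of K] by (simp add: K_def)
qed

theorem theorem1p3:
  fixes A :: "real^'n^'n" and p \<epsilon> :: real and w :: "real^'n \<Rightarrow> real"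
  assumes "invertible A"
    and "1 < p"
    and "0 < \<epsilon>" and "\<epsilon> < 1" and "\<epsilon> < p - 1"
    and "weight w"
    and "w \<in> Ap_class A p"
    and "(\<lambda>x. w x powr (1 - conj_exp p)) \<in> RH_class ((p - 1) / (p - \<epsilon> - 1))"
  shows "\<exists>C::real. \<forall>f\<in>Lp_weighted p w.
    (\<integral>\<^sup>+x. epowr (maximal_inv A f x) p * ennreal (w x) \<partial>lebesgue)
      \<le> ennreal C * (\<integral>\<^sup>+x. ennreal (\<bar>f x\<bar> powr p) * ennreal (w x) \<partial>lebesgue)"
proof -
  let ?T = "\<lambda>x. matrix_inv A *v x" and ?v = "\<lambda>x. w (A *v x)"
  \<comment> \<open>\<open>matrix_inv\<close> is defined by choice, and invertibility of
    \<open>A\<close> provides the existence that the choice relies on.\<close>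
  have "A ** matrix_inv A = mat 1 \<and> matrix_inv A ** A = mat 1"
    using assms(1) unfolding invertible_def matrix_inv_def by (rule someI_ex)
  then have inv: "A *v ?T x = x" "?T (A *v x) = x" for x
    by (simp_all add: matrix_vector_mul_assoc)
  obtain c where c: "c < top"
    "\<And>g. g \<in> borel_measurable lebesgue \<Longrightarrow> (\<integral>\<^sup>+x. g (?T x) \<partial>lebesgue) = c * (\<integral>\<^sup>+x. g x \<partial>lebesgue)"
    using nn_integral_lebesgue_linear[of ?T "(*v) A"] inv by (metis matrix_vector_mul_linear)
  have [measurable]: "w \<in> borel_measurable lebesgue"
    using assms(6) by (rule borel_measurable_weight)
  \<comment> \<open>The change of variables is used a second time, with the roles of
    \<open>A\<close> and its inverse swapped, to make \<open>?v\<close> Lebesgue measurable.\<close>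
  have [measurable]: "(*v) A \<in> lebesgue \<rightarrow>\<^sub>M lebesgue"
    using nn_integral_lebesgue_linear[of "(*v) A" ?T] inv by (metis matrix_vector_mul_linear)
  have v[measurable]: "?v \<in> borel_measurable lebesgue"
    by measurable
  \<comment> \<open>The lower exponent is \<open>q = p - \<epsilon>\<close>:
    \<open>\<epsilon> < p - 1\<close> gives \<open>1 < q\<close>, and \<open>0 < \<epsilon>\<close>
    gives \<open>q < p\<close>.\<close>
  have q: "1 < p - \<epsilon>" "p - \<epsilon> < p" using assms by auto
  obtain K where K: "0 \<le> K" "testing K (p - \<epsilon>) ?v w"
    using testing_of_reverse_Holder[OF q(1) assms(2,7,8)] by blast
  obtain C where C: "\<And>f. f \<in> borel_measurable lebesgue \<Longrightarrow>
      (\<integral>\<^sup>+x. epowr (maximal f x) p * ennreal (?v x) \<partial>lebesgue)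
      \<le> ennreal C * (\<integral>\<^sup>+x. ennreal (\<bar>f x\<bar> powr p) * ennreal (w x) \<partial>lebesgue)"
    using maximal_strong_type[OF K(2) _ q(2) K(1) v] q(1) by auto
  have "(\<integral>\<^sup>+x. epowr (maximal_inv A f x) p * ennreal (w x) \<partial>lebesgue)
      \<le> ennreal (enn2real c * max 0 C) * (\<integral>\<^sup>+x. ennreal (\<bar>f x\<bar> powr p) * ennreal (w x) \<partial>lebesgue)"
    if "f \<in> Lp_weighted p w" for f
  proof -
    have f: "f \<in> borel_measurable lebesgue" using that by (simp add: Lp_weighted_def)
    have [measurable]: "maximal f \<in> borel_measurable lebesgue"
      by (intro measurable_completion) simp
    \<comment> \<open>Since \<open>A *v ?T x = x\<close>, the weight \<open>w x\<close> equals
      \<open>?v (?T x)\<close>, so the whole integrand is a function of \<open>?T x\<close>.\<close>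
    have "(\<integral>\<^sup>+x. epowr (maximal_inv A f x) p * ennreal (w x) \<partial>lebesgue)
      = (\<integral>\<^sup>+x. epowr (maximal f (?T x)) p * ennreal (?v (?T x)) \<partial>lebesgue)"
      by (simp add: maximal_inv_def inv)
    also have "\<dots> = c * (\<integral>\<^sup>+x. epowr (maximal f x) p * ennreal (?v x) \<partial>lebesgue)"
      by (rule c(2)) simp
    also have "\<dots> \<le> c * (ennreal C * (\<integral>\<^sup>+x. ennreal (\<bar>f x\<bar> powr p) * ennreal (w x) \<partial>lebesgue))"
      by (intro mult_left_mono C f) simp
    \<comment> \<open>\<open>C\<close> may be negative, in which case \<open>ennreal C\<close> is
      \<open>0\<close>; replacing it by \<open>max 0 C\<close> lets the two constants be multiplied
      as reals.\<close>
    also have "c * (ennreal C * I) = ennreal (enn2real c * max 0 C) * I" for I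
      using c(1) by (simp add: ennreal_mult ennreal_max_0 mult.assoc)
    finally show ?thesis .
  qed
  then show ?thesis by blast
qed

end
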